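(* Let $n\ge 2$, let $K_n=(V,E)$ be the complete graph on the vertex set $V$ with $|V|=n$, and let $X,Y$ be two distinct cuts of $K_n$. Then the cones $K^{+}_{\max}(X)$ and $K^{+}_{\max}(Y)$ are adjacent (i.e. $\dim\big(K^{+}_{\max}(X)\cap K^{+}_{\max}(Y)\big)=d-1$, where $d=\binom{n}{2}$) if and only if one of the following holds: (i) $X$ and $Y$ are crossing; or (ii) $|X\ominus Y|=1$, or $|\bar X\ominus Y|=1$, or $|X\ominus\bar Y|=1$, or $|\bar X\ominus\bar Y|=1$, where $\ominus$ denotes symmetric difference and $\bar X=V\setminus X$.
   Context: Let $d=\binom{n}{2}=|E|$. For $S\subseteq V$, the cut vector $\mathbf{v}(S)\in\{0,1\}^{d}$ has coordinates indexed by edges $\{i,j\}\in E$, with $\mathbf{v}(S)_{i,j}=1$ if $|S\cap\{i,j\}|=1$ and $0$ otherwise. A cut is a nonempty proper subset $X\subset V$, where $X$ and its complement $\bar X=V\setminus X$ are identified (they have the same cut vector); the empty cut is excluded, so there are $2^{n-1}-1$ cuts. For a cut $X$, define the convex polyhedral cone $K^{+}_{\max}(X)=\{\mathbf{c}\in\mathbb{R}^{d}:\ \mathbf{c}\ge\mathbf{0},\ \langle\mathbf{c},\mathbf{v}(X)\rangle\ge\langle\mathbf{c},\mathbf{v}(Y)\rangle \text{ for all cuts } Y\}$. These cones form the cone partition of the nonnegative orthant for the max-cut problem with non-negative edge weights. Two such cones $K^{+}_{\max}(X),K^{+}_{\max}(Y)$ ($X\ne Y$) are called adjacent if $\dim\big(K^{+}_{\max}(X)\cap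 K^{+}_{\max}(Y)\big)=d-1$. Two subsets $A,B\subset V$ are crossing if $A\cap B\neq\emptyset$, $A\setminus B\ne\emptyset$, $B\setminus A\neq\emptyset$ and $V\setminus(A\cup B)\neq\emptyset$. *)

theory Defs
  imports "HOL-Analysis.Analysis" "HOL-Library.Cardinality"
begin

text \<open>
  The vertex set of the complete graph is the universe of a finite type with at least two
  elements (class \<open>card2\<close>), so that \<open>n = CARD('v)\<close> and \<open>n \<ge> 2\<close>. The edges form a
  type as well, so that \<open>real ^ 'v edge\<close> is the space of edge-indexed vectors.
\<close>

typedef (overloaded) ('v::card2) edge = "{e :: 'v set. card e = 2}"
  morphisms ends Abs_edge
proof -
  have "2 \<le> CARD('v)" by (rule two_le_card)
  then obtain e :: "'v set" where "card e = 2"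
    using obtain_subset_with_card_n by metis
  then show ?thesis by blast
qed

instance edge :: (card2) finite
proof
  have "(UNIV :: 'a edge set) = Abs_edge ` {e. card e = 2}"
    using type_definition.univ[OF type_definition_edge] .
  then show "finite (UNIV :: 'a edge set)" by (metis finite finite_imageI)
qed

lemma card_edge: "CARD('v::card2 edge) = CARD('v) choose 2"
proof -
  have "CARD('v edge) = card {e :: 'v set. card e = 2}"
    by (rule type_definition.card[OF type_definition_edge])
  then show ?thesis using n_subsets[of "UNIV :: 'v set" 2] by simp
qed

definition cut_vector :: "'v::card2 set \<Rightarrow> real ^ 'v edge" where
  "cut_vector S = (\<chi> e. if card (S \<inter> ends e) = 1 then 1 else 0)"

definition is_cut :: "'v::card2 set \<Rightarrow> bool" where
  "is_cut X \<longleftrightarrow> X \<noteq> {} \<and> X \<noteq> UNIV"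

text \<open>Cuts are represented by subsets, a subset and its complement being the same cut.\<close>

definition same_cut :: "'v::card2 set \<Rightarrow> 'v set \<Rightarrow> bool" where
  "same_cut X Y \<longleftrightarrow> X = Y \<or> X = - Y"

definition K_max_plus :: "'v::card2 set \<Rightarrow> (real ^ 'v edge) set" where
  "K_max_plus X = {c. (\<forall>e. 0 \<le> c $ e) \<and>
     (\<forall>Y. is_cut Y \<longrightarrow> c \<bullet> cut_vector X \<ge> c \<bullet> cut_vector Y)}"

definition adjacent_cones :: "'v::card2 set \<Rightarrow> 'v set \<Rightarrow> bool" where
  "adjacent_cones X Y \<longleftrightarrow>
     aff_dim (K_max_plus X \<inter> K_max_plus Y) = int (CARD('v) choose 2) - 1"

definition crossing :: "'v set \<Rightarrow> 'v set \<Rightarrow> bool" where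
  "crossing A B \<longleftrightarrow>
     A \<inter> B \<noteq> {} \<and> A - B \<noteq> {} \<and> B - A \<noteq> {} \<and> UNIV - (A \<union> B) \<noteq> {}"

end

theory Submission
  imports Defs
begin

text \<open>
  The common points of the two cones lie on the hyperplane orthogonal to
  \<open>v(X) - v(Y)\<close>, so adjacency means that they fill an open part of it.

  Sufficiency: every cut containing all edges separated by both \<open>X\<close> and \<open>Y\<close> is
  \<open>X\<close> or \<open>Y\<close>. Giving these edges a huge weight and balancing small positive weights on the
  remaining ones makes \<open>X\<close> and \<open>Y\<close> the only maximum cuts, and this persists under small
  perturbations inside the hyperplane.

  Necessity: otherwise one may assume \<open>X \<subset> Y\<close>, and \<open>B = Y - X\<close> has at least two elements.
  For a partition of \<open>B\<close> into \<open>B1\<close> and \<open>B2\<close>, the cuts \<open>X \<union> B1\<close> and \<open>X \<union> B2\<close> together contain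
  every edge as often as \<open>X\<close> and \<open>Y\<close> do, and the edges between \<open>B1\<close> and \<open>B2\<close> twice more. Hence the
  latter have weight zero, which cuts the dimension down once more.
\<close>

section \<open>Cut vectors coordinate by coordinate, and invariance under complements\<close>

lemma ends_obtain:
  obtains i j where "ends e = {i, j}" "i \<noteq> j"
  using ends[of e] by (auto simp: card_2_iff)

lemma edge_obtain:
  fixes i j :: "'v::card2"
  assumes "i \<noteq> j"
  obtains e where "ends e = {i, j}"
proof
  show "ends (Abs_edge {i, j}) = {i, j}"
    using assms by (simp add: Abs_edge_inverse)
qed

lemma cut_vector_nth:
  assumes "ends e = {i, j}" "i \<noteq> j"
  shows "cut_vector S $ e = (if (i \<in> S) \<noteq> (j \<in> S) then 1 else 0)"
proof -
  have "S \<inter> {i, j} = (if i \<in> S then {i} else {}) \<union> (if j \<in> S then {j} else {})"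
    by auto
  then show ?thesis
    using assms by (simp add: cut_vector_def)
qed

lemma cut_vector_Compl: "cut_vector (- S) = cut_vector S"
proof (rule vec_eq_iff[THEN iffD2], rule allI)
  fix e :: "'a edge"
  obtain i j where "ends e = {i, j}" "i \<noteq> j" by (rule ends_obtain)
  then show "cut_vector (- S) $ e = cut_vector S $ e"
    by (simp add: cut_vector_nth)
qed

lemma is_cut_Compl: "is_cut (- S) \<longleftrightarrow> is_cut S"
  by (auto simp: is_cut_def)

lemma K_max_plus_Compl: "K_max_plus (- X) = K_max_plus X"
  by (simp add: K_max_plus_def cut_vector_Compl)

lemma adjacent_cones_Compl:
  "adjacent_cones (- X) Y = adjacent_cones X Y"
  "adjacent_cones X (- Y) = adjacent_cones X Y"
  by (simp_all add: adjacent_cones_def K_max_plus_Compl)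

lemma adjacent_cones_commute: "adjacent_cones X Y = adjacent_cones Y X"
  by (simp add: adjacent_cones_def Int_commute)

section \<open>The hyperplane containing the common points of two cones\<close>

lemma K_max_plus_Int_subset_hyperplane:
  assumes "is_cut X" "is_cut Y"
  shows "K_max_plus X \<inter> K_max_plus Y \<subseteq> {c. (cut_vector X - cut_vector Y) \<bullet> c = 0}"
proof
  fix c assume "c \<in> K_max_plus X \<inter> K_max_plus Y"
  then have "c \<bullet> cut_vector X = c \<bullet> cut_vector Y"
    using assms by (intro antisym) (simp_all add: K_max_plus_def)
  then show "c \<in> {c. (cut_vector X - cut_vector Y) \<bullet> c = 0}"
    by (simp add: inner_diff_left inner_commute[of _ c])
qed

lemma aff_dim_cut_hyperplane:
  fixes X Y :: "'v::card2 set"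
  assumes "cut_vector X \<noteq> cut_vector Y"
  shows "aff_dim {c. (cut_vector X - cut_vector Y) \<bullet> c = 0} = int (CARD('v) choose 2) - 1"
proof -
  \<comment> \<open>At least one edge exists, so subtracting 1 from the number of edges is not
    truncated in the naturals.\<close>
  have "1 \<le> CARD('v edge)" by (simp add: Suc_le_eq)
  then have "1 \<le> CARD('v) choose 2" by (simp only: card_edge)
  then show ?thesis
    using assms by (simp add: aff_dim_hyperplane card_edge of_nat_diff)
qed

section \<open>Cuts as edge sets\<close>

definition cut_edges :: "'v::card2 set \<Rightarrow> 'v edge set" where
  "cut_edges S = {e. cut_vector S $ e = 1}"

lemma mem_cut_edges_iff:
  assumes "ends e = {i, j}" "i \<noteq> j"
  shows "e \<in> cut_edges S \<longleftrightarrow> (i \<in> S) \<noteq> (j \<in> S)"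
  by (simp add: cut_edges_def cut_vector_nth[OF assms])

lemma inner_cut_vector: "c \<bullet> cut_vector S = (\<Sum>e\<in>cut_edges S. c $ e)"
proof -
  have "c \<bullet> cut_vector S = (\<Sum>e\<in>UNIV. if e \<in> cut_edges S then c $ e else 0)"
    unfolding inner_vec_def
    by (rule sum.cong) (auto simp: cut_edges_def cut_vector_def)
  then show ?thesis by (simp add: sum.If_cases)
qed

text \<open>The edges of a cut form a complete bipartite graph on all vertices. It is connected, so
  its bipartition is unique up to swapping the sides.\<close>

lemma cut_edges_subsetD:
  assumes "cut_edges X \<subseteq> cut_edges Y" "is_cut X"
  shows "same_cut X Y"
proof -
  have sep: "(i \<in> Y) \<noteq> (j \<in> Y)" if ij: "i \<in> X" "j \<notin> X" for i j
  proof -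
    have "i \<noteq> j" using ij by auto
    then obtain e where e: "ends e = {i, j}" by (rule edge_obtain)
    then show ?thesis
      using assms(1) ij mem_cut_edges_iff[OF e \<open>i \<noteq> j\<close>] by blast
  qed
  obtain a b where "a \<in> X" "b \<notin> X"
    using assms(2) by (auto simp: is_cut_def)
  with sep have "X = Y \<or> X = - Y" by blast
  then show ?thesis by (simp add: same_cut_def)
qed

text \<open>The common edges join \<open>X \<inter> Y\<close> to the outside of
  \<open>X \<union> Y\<close>, and \<open>X - Y\<close> to \<open>Y - X\<close>. If the cuts cross,
  this gives two connected bipartite graphs, and the two ways of combining their colourings are
  \<open>X\<close> and \<open>Y\<close>. If the cuts differ in one vertex, that vertex is isolated,
  and its two possible sides give \<open>X\<close> and \<open>Y\<close>.\<close>

lemma cut_edges_determine: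
  fixes X Y Z :: "'v::card2 set"
  assumes "is_cut X" "is_cut Y"
    and "crossing X Y \<or>
      (card (sym_diff X Y) = 1 \<or> card (sym_diff (- X) Y) = 1 \<or>
       card (sym_diff X (- Y)) = 1 \<or> card (sym_diff (- X) (- Y)) = 1)"
    and "cut_edges X \<inter> cut_edges Y \<subseteq> cut_edges Z"
  shows "same_cut Z X \<or> same_cut Z Y"
proof -
  have sep: "(i \<in> Z) \<noteq> (j \<in> Z)" if ij: "(i \<in> X) \<noteq> (j \<in> X)" "(i \<in> Y) \<noteq> (j \<in> Y)" for i j
  proof -
    have "i \<noteq> j" using ij by auto
    then obtain e where e: "ends e = {i, j}" by (rule edge_obtain)
    then show ?thesis
      using assms(4) ij mem_cut_edges_iff[OF e \<open>i \<noteq> j\<close>] by blast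
  qed
  have single: "same_cut Z A \<or> same_cut Z B"
    if cuts: "is_cut A" "is_cut B" and b: "sym_diff A B = {b}"
      and sepAB: "\<And>i j. (i \<in> A) \<noteq> (j \<in> A) \<Longrightarrow> (i \<in> B) \<noteq> (j \<in> B) \<Longrightarrow> (i \<in> Z) \<noteq> (j \<in> Z)"
    for A B :: "'v set" and b
  proof -
    have eq: "x \<in> A \<longleftrightarrow> x \<in> B" if "x \<noteq> b" for x using b that by blast
    have neq: "b \<in> A \<longleftrightarrow> b \<notin> B" using b by blast
    \<comment> \<open>Both sides of \<open>A\<close> have a vertex besides \<open>b\<close>:
      \<open>A = {b}\<close> would make \<open>B\<close> empty, and \<open>- A = {b}\<close> would
      make \<open>B\<close> everything.\<close>
    obtain p where p: "p \<in> A" "p \<noteq> b"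
      using cuts eq neq unfolding is_cut_def by (metis all_not_in_conv)
    obtain s where s: "s \<notin> A" "s \<noteq> b"
      using cuts eq neq unfolding is_cut_def by (metis UNIV_eq_I)
    have mem: "x \<in> Z \<longleftrightarrow> (x \<in> A \<longleftrightarrow> p \<in> Z)" if "x \<noteq> b" for x
      using sepAB[of p x] sepAB[of p s] sepAB[of x s] eq[OF that] eq[OF p(2)] eq[OF s(2)] p s
      by blast
    consider "b \<in> Z \<longleftrightarrow> (b \<in> A \<longleftrightarrow> p \<in> Z)" | "b \<in> Z \<longleftrightarrow> (b \<in> B \<longleftrightarrow> p \<in> Z)"
      using neq by blast
    then show ?thesis
    proof cases
      case 1
      then have "\<forall>x. x \<in> Z \<longleftrightarrow> (x \<in> A \<longleftrightarrow> p \<in> Z)" using mem by metis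
      then show ?thesis unfolding same_cut_def by blast
    next
      case 2
      then have "\<forall>x. x \<in> Z \<longleftrightarrow> (x \<in> B \<longleftrightarrow> p \<in> Z)" using mem eq by metis
      then show ?thesis unfolding same_cut_def by blast
    qed
  qed
  consider "crossing X Y" | b where "sym_diff X Y = {b}" | b where "sym_diff (- X) Y = {b}"
  proof -
    have "sym_diff X (- Y) = sym_diff (- X) Y" "sym_diff (- X) (- Y) = sym_diff X Y"
      by auto
    then show ?thesis
      using assms(3) that by (metis card_1_singletonE)
  qed
  then show ?thesis
  proof cases
    case 1
    then obtain p q r s where mem: "p \<in> X" "p \<in> Y" "q \<in> X" "q \<notin> Y" "r \<notin> X" "r \<in> Y" "s \<notin> X" "s \<notin> Y"
      unfolding crossing_def by blast
    \<comment> \<open>\<open>p\<close> fixes the colouring on the cells where \<open>X\<close> and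
      \<open>Y\<close> agree, \<open>q\<close> on those where they differ. Equal colours of
      \<open>p\<close> and \<open>q\<close> yield \<open>X\<close>, different ones
      \<open>Y\<close>.\<close>
    have PS: "x \<in> Z \<longleftrightarrow> (x \<in> X \<longleftrightarrow> p \<in> Z)" if "x \<in> X \<longleftrightarrow> x \<in> Y" for x
      using sep[of p x] sep[of x s] sep[of p s] mem that by blast
    have QR: "x \<in> Z \<longleftrightarrow> (x \<in> X \<longleftrightarrow> q \<in> Z)" if "x \<in> X \<longleftrightarrow> x \<notin> Y" for x
      using sep[of q x] sep[of x r] sep[of q r] mem that by blast
    show ?thesis
    proof (cases "p \<in> Z \<longleftrightarrow> q \<in> Z")
      case True
      then have "\<forall>x. x \<in> Z \<longleftrightarrow> (x \<in> X \<longleftrightarrow> p \<in> Z)" using PS QR by blast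
      then show ?thesis unfolding same_cut_def by blast
    next
      case False
      then have "\<forall>x. x \<in> Z \<longleftrightarrow> (x \<in> Y \<longleftrightarrow> p \<in> Z)" using PS QR by blast
      then show ?thesis unfolding same_cut_def by blast
    qed
  next
    case 2
    then show ?thesis using single[of X Y] assms(1,2) sep by blast
  next
    case 3
    then have "same_cut Z (- X) \<or> same_cut Z Y"
      using single[of "- X" Y] assms(1,2) sep by (simp add: is_cut_Compl)
    then show ?thesis by (auto simp: same_cut_def)
  qed
qed

section \<open>Sufficiency: an open piece of the hyperplane\<close>

lemma weight_with_two_maximum_cuts:
  fixes X Y :: "'v::card2 set"
  assumes "\<not> cut_edges X \<subseteq> cut_edges Y" "\<not> cut_edges Y \<subseteq> cut_edges X"
  obtains c where "\<And>e. 0 < c $ e" "c \<bullet> cut_vector X = c \<bullet> cut_vector Y"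
    "\<And>Z. \<not> cut_edges X \<inter> cut_edges Y \<subseteq> cut_edges Z \<Longrightarrow> c \<bullet> cut_vector Z < c \<bullet> cut_vector X"
proof -
  define D P Q where "D = cut_edges X \<inter> cut_edges Y"
    and "P = cut_edges X - cut_edges Y" and "Q = cut_edges Y - cut_edges X"
  note defs = D_def P_def Q_def
  define M where "M = real CARD('v edge)"
  have M: "0 < M" by (simp add: M_def)
  have card_PQ: "1 \<le> card P" "1 \<le> card Q"
    using assms by (auto simp: defs Suc_le_eq card_gt_0_iff)
  \<comment> \<open>The edges in \<open>P\<close> and those in \<open>Q\<close> each share a total
    weight of 1, which balances \<open>X\<close> and \<open>Y\<close>.\<close>
  define c :: "real ^ 'v edge" where
    "c = (\<chi> e. if e \<in> D then M else if e \<in> P then 1 / card P else if e \<in> Q then 1 / card Q else 1)"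
  have pos: "0 < c $ e" for e
    using M card_PQ by (simp add: c_def)
  have small: "c $ e \<le> 1" if "e \<notin> D" for e
    using that card_PQ by (simp add: c_def)
  have sumD: "(\<Sum>e\<in>A. c $ e) = M * card A" if "A \<subseteq> D" for A
  proof -
    have "(\<Sum>e\<in>A. c $ e) = (\<Sum>e\<in>A. M)" using that by (intro sum.cong) (auto simp: c_def)
    then show ?thesis by simp
  qed
  have sumP: "(\<Sum>e\<in>P. c $ e) = 1"
  proof -
    have "(\<Sum>e\<in>P. c $ e) = (\<Sum>e\<in>P. 1 / card P)" by (intro sum.cong) (auto simp: c_def defs)
    then show ?thesis using card_PQ by auto
  qed
  have sumQ: "(\<Sum>e\<in>Q. c $ e) = 1"
  proof -
    have "(\<Sum>e\<in>Q. c $ e) = (\<Sum>e\<in>Q. 1 / card Q)" by (intro sum.cong) (auto simp: c_def defs)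
    then show ?thesis using card_PQ by auto
  qed
  have X: "c \<bullet> cut_vector X = M * card D + 1"
  proof -
    have "cut_edges X = D \<union> P" "D \<inter> P = {}" by (auto simp: defs)
    then show ?thesis by (simp add: inner_cut_vector sum.union_disjoint sumD sumP)
  qed
  have Y: "c \<bullet> cut_vector Y = M * card D + 1"
  proof -
    have "cut_edges Y = D \<union> Q" "D \<inter> Q = {}" by (auto simp: defs)
    then show ?thesis by (simp add: inner_cut_vector sum.union_disjoint sumD sumQ)
  qed
  have Z: "c \<bullet> cut_vector Z < c \<bullet> cut_vector X"
    if "\<not> cut_edges X \<inter> cut_edges Y \<subseteq> cut_edges Z" for Z
  proof -
    \<comment> \<open>Missing a common edge costs at least \<open>M\<close>. The edges outside
      \<open>D\<close> number at most \<open>M\<close> and weigh at most 1 each, so they can just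
      make up for it; the extra 1 in the value of \<open>X\<close> makes the inequality
      strict.\<close>
    let ?E = "cut_edges Z"
    have "?E \<inter> D \<subset> D" using that by (auto simp: D_def)
    then have "card (?E \<inter> D) < card D" by (simp add: psubset_card_mono)
    then have "real (card (?E \<inter> D)) \<le> real (card D) - 1" by linarith
    then have "M * card (?E \<inter> D) \<le> M * (real (card D) - 1)"
      using M by (intro mult_left_mono) auto
    moreover have "(\<Sum>e\<in>?E - D. c $ e) \<le> real (card (?E - D)) * 1"
      by (rule sum_bounded_above) (use small in auto)
    moreover have "real (card (?E - D)) \<le> M"
      unfolding M_def by (simp add: card_mono)
    moreover have "c \<bullet> cut_vector Z = (\<Sum>e\<in>?E \<inter> D. c $ e) + (\<Sum>e\<in>?E - D. c $ e)"
      by (simp add: inner_cut_vector sum.Int_Diff[of ?E _ D])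
    ultimately show ?thesis
      unfolding X by (simp add: sumD algebra_simps)
  qed
  show ?thesis using that[of c] pos X Y Z by simp
qed

text \<open>The intersection of the cones is squeezed between the hyperplane and a nonempty
  relatively open part of it, which have the same dimension.\<close>

lemma adjacent_cones_if_common_edges_determine:
  fixes X Y :: "'v::card2 set"
  assumes cuts: "is_cut X" "is_cut Y" and neq: "\<not> same_cut X Y"
    and det: "\<And>Z. cut_edges X \<inter> cut_edges Y \<subseteq> cut_edges Z \<Longrightarrow> same_cut Z X \<or> same_cut Z Y"
  shows "adjacent_cones X Y"
proof -
  let ?H = "{c. (cut_vector X - cut_vector Y) \<bullet> c = 0}"
  let ?K = "K_max_plus X \<inter> K_max_plus Y"
  have nsub: "\<not> cut_edges X \<subseteq> cut_edges Y" "\<not> cut_edges Y \<subseteq> cut_edges X"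
    using cut_edges_subsetD cuts neq by (auto simp: same_cut_def)
  then have vneq: "cut_vector X \<noteq> cut_vector Y" by (auto simp: cut_edges_def)
  obtain c where c: "\<And>e. 0 < c $ e" "c \<bullet> cut_vector X = c \<bullet> cut_vector Y"
    "\<And>Z. \<not> cut_edges X \<inter> cut_edges Y \<subseteq> cut_edges Z \<Longrightarrow> c \<bullet> cut_vector Z < c \<bullet> cut_vector X"
    using weight_with_two_maximum_cuts[OF nsub] by blast
  \<comment> \<open>These are finitely many strict inequalities, so \<open>U\<close> is open. Sets
    representing the cut \<open>X\<close> or \<open>Y\<close> are left out because on the hyperplane
    they attain equality.\<close>
  define U where "U = (\<Inter>e. {c. 0 < c $ e}) \<inter>
    (\<Inter>Z\<in>{Z. \<not> same_cut Z X \<and> \<not> same_cut Z Y}. {c. c \<bullet> cut_vector Z < c \<bullet> cut_vector X})"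
  have "open U"
    unfolding U_def
    by (intro open_Int open_INT finite ballI open_Collect_less continuous_intros)
  moreover have "c \<in> U \<inter> ?H"
  proof -
    have "c \<bullet> cut_vector Z < c \<bullet> cut_vector X" if "\<not> same_cut Z X" "\<not> same_cut Z Y" for Z
      using c(3) det that by blast
    then show ?thesis
      using c(1,2) by (simp add: U_def inner_diff_left inner_commute[of _ c])
  qed
  moreover have "convex ?H" by (rule convex_hyperplane)
  ultimately have "aff_dim (?H \<inter> U) = aff_dim ?H"
    by (intro aff_dim_convex_Int_open) auto
  moreover have "?H \<inter> U \<subseteq> ?K"
  proof
    fix a assume a: "a \<in> ?H \<inter> U"
    then have eq: "a \<bullet> cut_vector X = a \<bullet> cut_vector Y"
      by (simp add: inner_diff_left inner_commute[of _ a])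
    have "a \<bullet> cut_vector Z \<le> a \<bullet> cut_vector X" for Z
    proof (cases "same_cut Z X \<or> same_cut Z Y")
      case True
      then show ?thesis using eq by (auto simp: same_cut_def cut_vector_Compl)
    next
      case False
      then show ?thesis using a by (auto simp: U_def less_imp_le)
    qed
    moreover have "0 \<le> a $ e" for e using a by (auto simp: U_def less_imp_le)
    ultimately show "a \<in> ?K" using eq by (simp add: K_max_plus_def)
  qed
  moreover have "?K \<subseteq> ?H" using K_max_plus_Int_subset_hyperplane[OF cuts] .
  ultimately have "aff_dim ?K = aff_dim ?H"
    by (metis aff_dim_subset antisym)
  then show ?thesis
    by (simp add: adjacent_cones_def aff_dim_cut_hyperplane[OF vneq])
qed

section \<open>Necessity: a second equation for nested cuts\<close>

lemma K_max_plus_nested_weight_eq_0: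
  fixes X Y :: "'v::card2 set"
  assumes cuts: "is_cut X" "is_cut Y" and "X \<subseteq> Y" and b: "b \<in> Y - X" "b' \<in> Y - X" "b \<noteq> b'"
    and e: "ends e = {b, b'}" and c: "c \<in> K_max_plus X" "c \<in> K_max_plus Y"
  shows "c $ e = 0"
proof -
  \<comment> \<open>This is the exchange with \<open>B1 = {b}\<close> and \<open>B2\<close> the rest
    of \<open>Y - X\<close>. The vertex \<open>b'\<close> keeps \<open>?X1\<close> from being
    everything and \<open>?X2\<close> from being empty.\<close>
  let ?X1 = "insert b X" and ?X2 = "Y - {b}"
  have "is_cut ?X1" "is_cut ?X2"
    using cuts b \<open>X \<subseteq> Y\<close> by (auto simp: is_cut_def)
  then have "c \<bullet> cut_vector ?X1 \<le> c \<bullet> cut_vector X" "c \<bullet> cut_vector ?X2 \<le> c \<bullet> cut_vector Y"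
    using c by (auto simp: K_max_plus_def)
  \<comment> \<open>Neither \<open>X\<close> nor \<open>Y\<close> separates the ends of
    \<open>e\<close>, but both new cuts do; every other edge is counted at least as often as before.
    Maximality of \<open>X\<close> and \<open>Y\<close> then forces twice the weight of
    \<open>e\<close> to be at most 0.\<close>
  moreover have "c \<bullet> (cut_vector X + cut_vector Y + 2 *\<^sub>R axis e 1)
      \<le> c \<bullet> (cut_vector ?X1 + cut_vector ?X2)"
    unfolding inner_vec_def
  proof (rule sum_mono)
    fix f :: "'v edge"
    obtain i j where f: "ends f = {i, j}" "i \<noteq> j" by (rule ends_obtain)
    have "0 \<le> c $ f" using c by (simp add: K_max_plus_def)
    moreover have "(cut_vector X + cut_vector Y + 2 *\<^sub>R axis e 1) $ f
        \<le> (cut_vector ?X1 + cut_vector ?X2) $ f"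
    proof (cases "f = e")
      case True
      then show ?thesis using b e by (simp add: cut_vector_nth[OF e])
    next
      case False
      then have "axis e (1::real) $ f = 0" by (simp add: axis_def)
      then show ?thesis using b f(2) \<open>X \<subseteq> Y\<close>
        by (auto simp: cut_vector_nth[OF f])
    qed
    ultimately show "c $ f \<bullet> (cut_vector X + cut_vector Y + 2 *\<^sub>R axis e 1) $ f
        \<le> c $ f \<bullet> (cut_vector ?X1 + cut_vector ?X2) $ f"
      by (simp only: inner_real_def mult_left_mono)
  qed
  moreover have "0 \<le> c $ e" using c by (simp add: K_max_plus_def)
  ultimately show ?thesis by (simp add: inner_add_right inner_axis)
qed

lemma adjacent_cones_nested_card:
  fixes X Y :: "'v::card2 set"
  assumes cuts: "is_cut X" "is_cut Y" and "X \<subset> Y" and adj: "adjacent_cones X Y"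
  shows "card (Y - X) = 1"
proof (rule ccontr)
  assume "card (Y - X) \<noteq> 1"
  moreover have "Y - X \<noteq> {}" using \<open>X \<subset> Y\<close> by blast
  ultimately obtain b b' where b: "b \<in> Y - X" "b' \<in> Y - X" "b \<noteq> b'"
    by (metis is_singletonI' is_singleton_altdef)
  obtain e where e: "ends e = {b, b'}" using b(3) by (rule edge_obtain)
  let ?H = "{c. (cut_vector X - cut_vector Y) \<bullet> c = 0}"
  let ?L = "?H \<inter> {c. axis e 1 \<bullet> c = 0}"
  have "\<not> same_cut X Y"
    using cuts \<open>X \<subset> Y\<close> by (auto simp: same_cut_def is_cut_def)
  then have vneq: "cut_vector X \<noteq> cut_vector Y"
    using cut_edges_subsetD[of X Y] cuts by (auto simp: cut_edges_def)
  have "K_max_plus X \<inter> K_max_plus Y \<subseteq> ?L"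
    using K_max_plus_Int_subset_hyperplane[OF cuts]
      K_max_plus_nested_weight_eq_0[OF cuts _ b e] \<open>X \<subset> Y\<close>
    by (auto simp: inner_axis')
  then have "aff_dim (K_max_plus X \<inter> K_max_plus Y) \<le> aff_dim ?L" by (rule aff_dim_subset)
  also have "aff_dim ?L < aff_dim ?H"
  proof (rule aff_dim_psubset)
    have "affine ?L" "affine ?H" by (intro affine_Int affine_hyperplane)+
    \<comment> \<open>Neither cut separates \<open>b\<close> from \<open>b'\<close>, so the unit
      vector of \<open>e\<close> satisfies the hyperplane equation but violates the new one.\<close>
    moreover have "axis e 1 \<in> ?H - ?L"
      using b by (simp add: inner_axis inner_axis_axis cut_vector_nth[OF e])
    ultimately show "affine hull ?L \<subset> affine hull ?H"
      by (metis DiffE Int_lower1 hull_same psubsetI)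
  qed
  finally show False
    using adj by (simp add: adjacent_cones_def aff_dim_cut_hyperplane[OF vneq])
qed

section \<open>The equivalence for arbitrary pairs of cuts\<close>

theorem theorem3:
  fixes X Y :: "'v::card2 set"
  assumes "is_cut X" and "is_cut Y" and "\<not> same_cut X Y"
  shows "adjacent_cones X Y \<longleftrightarrow>
    crossing X Y \<or>
    (card (sym_diff X Y) = 1 \<or> card (sym_diff (- X) Y) = 1 \<or>
     card (sym_diff X (- Y)) = 1 \<or> card (sym_diff (- X) (- Y)) = 1)"
    (is "_ \<longleftrightarrow> ?R")
proof
  assume adj: "adjacent_cones X Y"
  have nested: "card (sym_diff A B) = 1"
    if "is_cut A" "is_cut B" "A \<subseteq> B" "A \<noteq> B" "adjacent_cones A B" for A B :: "'v set"
  proof -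
    have "sym_diff A B = B - A" using that by blast
    then show ?thesis using adjacent_cones_nested_card[of A B] that by auto
  qed
  have neq: "X \<noteq> Y" "X \<noteq> - Y" "- X \<noteq> Y"
    using assms(3) by (auto simp: same_cut_def)
  show ?R
  proof (cases "crossing X Y")
    case False
    \<comment> \<open>Each case is the emptiness of one of the four cells. Up to complements, which
      leave the cones unchanged, it makes the pair nested.\<close>
    then consider "X \<subseteq> - Y" | "X \<subseteq> Y" | "Y \<subseteq> X" | "- X \<subseteq> Y"
      unfolding crossing_def by blast
    then show ?thesis
    proof cases
      case 1
      then show ?thesis
        using nested[of X "- Y"] assms neq adj by (simp add: is_cut_Compl adjacent_cones_Compl)
    next
      case 2
      then show ?thesis using nested[of X Y] assms neq adj by simp
    next
      case 3
      then have "card (sym_diff Y X) = 1"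
        using nested[of Y X] assms neq adj adjacent_cones_commute by blast
      then show ?thesis by (simp add: Un_commute)
    next
      case 4
      then show ?thesis
        using nested[of "- X" Y] assms neq adj by (simp add: is_cut_Compl adjacent_cones_Compl)
    qed
  qed simp
next
  assume ?R
  then show "adjacent_cones X Y"
    using adjacent_cones_if_common_edges_determine cut_edges_determine assms by blast
qed

end
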